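(* If $G$ is a cyclic group of order $|G|\ge 3$, then $s_{\min}(G)=2$ if $|G|$ is even and $s_{\min}(G)=3$ if $|G|$ is odd.
   Context: For a finite abelian group $G$ with $n=|G|$, let $\mathcal C(G)$ be the set of Hamiltonian cycles in the complete digraph on vertex set $G$; a cycle is written $C=(g_1,\ldots,g_n)$, a listing of all elements of $G$, indices modulo $n$. Let $S(C)=\{g_i+g_{i+1} : 1\le i\le n\}$ (indices mod $n$) and $s_{\min}(G)=\min\{|S(C)| : C\in\mathcal C(G)\}$. *)

theory Defs
  imports
    "HOL-Algebra.Elementary_Groups"
    "Graph_Theory.Pair_Digraph"
begin

definition complete_digraph_on :: "'a set \<Rightarrow> 'a pair_pre_digraph" where
  "complete_digraph_on V = \<lparr> pverts = V, parcs = {(u, v). u \<in> V \<and> v \<in> V \<and> u \<noteq> v} \<rparr>"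

text \<open>
  A cycle is given by the listing \<open>g\<^sub>1, \<dots>, g\<^sub>n\<close> of its vertices. In a pair digraph an arc is the
  pair of its ends, so \<open>zip g (rotate1 g)\<close> is the list of arcs
  \<open>(g\<^sub>1, g\<^sub>2), \<dots>, (g\<^sub>n\<^sub>-\<^sub>1, g\<^sub>n), (g\<^sub>n, g\<^sub>1)\<close>.
\<close>

definition hamiltonian_cycle :: "'a pair_pre_digraph \<Rightarrow> 'a list \<Rightarrow> bool" where
  "hamiltonian_cycle D g \<longleftrightarrow>
     pre_digraph.cycle (with_proj D) (zip g (rotate1 g)) \<and> set g = pverts D"

definition ham_cycles :: "('a, 'b) monoid_scheme \<Rightarrow> 'a list set" where
  "ham_cycles G = {g. hamiltonian_cycle (complete_digraph_on (carrier G)) g}"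

definition cycle_sums :: "('a, 'b) monoid_scheme \<Rightarrow> 'a list \<Rightarrow> 'a set" where
  "cycle_sums G g = {g ! i \<otimes>\<^bsub>G\<^esub> g ! (Suc i mod length g) | i. i < length g}"

text \<open>
  The minimum is taken over a nonempty finite set as soon as \<open>G\<close> is finite with at least two
  elements (see \<open>ham_cycles_eq\<close>); \<open>s_min G\<close> is unspecified for the trivial group, as the complete
  digraph has no loops.
\<close>

definition s_min :: "('a, 'b) monoid_scheme \<Rightarrow> nat" where
  "s_min G = Min ((\<lambda>g. card (cycle_sums G g)) ` ham_cycles G)"

lemma cas_zip:
  "pre_digraph.cas (with_proj D) x (zip (x # xs) (xs @ [y])) y"
  by (induction xs arbitrary: x) (auto simp: pre_digraph.cas.simps)

lemma awalk_verts_zip: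
  "pre_digraph.awalk_verts (with_proj D) u (zip (x # xs) (xs @ [y])) = x # xs @ [y]"
  by (induction xs arbitrary: x u) (auto simp: pre_digraph.awalk_verts.simps)

lemma hamiltonian_cycle_iff:
  "hamiltonian_cycle D g \<longleftrightarrow>
     g \<noteq> [] \<and> distinct g \<and> set g = pverts D \<and>
     (\<forall>i<length g. (g ! i, g ! (Suc i mod length g)) \<in> parcs D)"
proof (cases g)
  case Nil
  then show ?thesis by (simp add: hamiltonian_cycle_def pre_digraph.cycle_def)
next
  case (Cons x xs)
  let ?p = "zip g (rotate1 g)"
  have p: "?p = zip (x # xs) (xs @ [x])" using Cons by simp
  have verts: "pre_digraph.awalk_verts (with_proj D) u ?p = x # xs @ [x]" for u
    unfolding p by (rule awalk_verts_zip)
  have cas: "pre_digraph.cas (with_proj D) x ?p x"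
    unfolding p by (rule cas_zip)
  have cas_eq: "u = x" if "pre_digraph.cas (with_proj D) u ?p u" for u
    using that unfolding p by (cases xs) (auto simp: pre_digraph.cas.simps)
  have arcs: "set ?p \<subseteq> parcs D \<longleftrightarrow>
      (\<forall>i<length g. (g ! i, g ! (Suc i mod length g)) \<in> parcs D)"
    by (auto simp: set_zip nth_rotate1)
  have ends: "(\<exists>u. pre_digraph.cas (with_proj D) u ?p u \<and> P u) \<longleftrightarrow> P x" for P
    using cas cas_eq by blast
  have dist: "distinct (tl (x # xs @ [x])) \<longleftrightarrow> distinct g"
    using Cons by auto
  have ne: "?p \<noteq> []"
    unfolding p by (cases xs) simp_all
  have "pre_digraph.cycle (with_proj D) ?p \<longleftrightarrow>
      (\<exists>u. pre_digraph.cas (with_proj D) u ?p u \<and>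
         u \<in> pverts D \<and> set ?p \<subseteq> parcs D \<and> distinct g)"
    unfolding pre_digraph.cycle_def pre_digraph.awalk_def verts dist with_proj_simps
    using ne by blast
  then have cyc: "pre_digraph.cycle (with_proj D) ?p \<longleftrightarrow>
      x \<in> pverts D \<and> set ?p \<subseteq> parcs D \<and> distinct g"
    unfolding ends .
  have "x \<in> set g" "g \<noteq> []" using Cons by simp_all
  then show ?thesis
    unfolding hamiltonian_cycle_def cyc arcs by blast
qed

lemma ham_cycles_eq:
  assumes "card (carrier G) \<ge> 2"
  shows "ham_cycles G = {g. distinct g \<and> set g = carrier G}"
proof -
  have "g \<noteq> [] \<and> (\<forall>i<length g. (g ! i, g ! (Suc i mod length g)) \<in>
          parcs (complete_digraph_on (carrier G)))"
    if "distinct g" "set g = carrier G" for g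
  proof -
    have len: "length g \<ge> 2"
      using assms that distinct_card[of g] by simp
    have "g ! i \<noteq> g ! (Suc i mod length g)" if "i < length g" for i
    proof -
      have "i \<noteq> Suc i mod length g"
        using len that by (cases "Suc i = length g") auto
      moreover have "Suc i mod length g < length g"
        using that by (intro mod_less_divisor) linarith
      ultimately show ?thesis
        using nth_eq_iff_index_eq[OF \<open>distinct g\<close>] that by blast
    qed
    moreover have "g ! i \<in> carrier G \<and> g ! (Suc i mod length g) \<in> carrier G" if "i < length g" for i
    proof -
      have "Suc i mod length g < length g"
        using that by (intro mod_less_divisor) linarith
      then show ?thesis
        using that \<open>set g = carrier G\<close> nth_mem by blast
    qed
    moreover have "g \<noteq> []"
      using len by (cases g) simp_all
    ultimately show ?thesis
      by (simp add: complete_digraph_on_def)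
  qed
  moreover have "pverts (complete_digraph_on (carrier G)) = carrier G"
    by (simp add: complete_digraph_on_def)
  ultimately show ?thesis
    unfolding ham_cycles_def hamiltonian_cycle_iff by auto
qed

end

theory Submission
  imports Defs "HOL-Algebra.Multiplicative_Group"
begin

text \<open>
  Cancelling the common term shows that consecutive sums of a cycle differ, so there are at
  least two sums, and at least three when the cycle has odd length, because two values would have
  to alternate. Identifying the group with the integers modulo \<open>n\<close>, the bounds are attained by the
  cycle \<open>0, -1, 2, -3, \<dots>\<close> with sums \<open>-1\<close> and \<open>1\<close> when \<open>n\<close> is even, and by
  \<open>0, -1, 1, -2, 2, \<dots>\<close> with sums \<open>-1\<close>, \<open>0\<close> and the closing sum \<open>(n - 1) / 2\<close> when \<open>n\<close> is odd.
\<close>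

text \<open>On a cycle of length 2, two steps lead back to the start; this is where length at least
  3 enters the lower bounds.\<close>

lemma Suc_mod_Suc_mod_neq:
  assumes "n \<ge> 3" "i < n"
  shows "Suc (Suc i mod n) mod n \<noteq> i"
proof -
  consider "Suc (Suc i) < n" | "Suc (Suc i) = n" | "Suc i = n"
    using assms by linarith
  then show ?thesis
    using assms by cases auto
qed

lemma card_image_ge_2_if_consecutive_neq:
  fixes n :: nat
  assumes "n > 0" and "\<And>i. i < n \<Longrightarrow> f i \<noteq> f (Suc i mod n)"
  shows "card (f ` {..<n}) \<ge> 2"
proof -
  have "{f 0, f (Suc 0 mod n)} \<subseteq> f ` {..<n}"
    using assms(1) by auto
  moreover have "card {f 0, f (Suc 0 mod n)} = 2"
    using assms(2)[OF assms(1)] by (subst card_2_iff) blast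
  ultimately show ?thesis
    by (metis card_mono finite_imageI finite_lessThan)
qed

lemma card_image_ge_3_if_consecutive_neq:
  fixes n :: nat
  assumes "odd n" and neq: "\<And>i. i < n \<Longrightarrow> f i \<noteq> f (Suc i mod n)"
  shows "card (f ` {..<n}) \<ge> 3"
proof (rule ccontr)
  have "n > 0" using assms(1) by (rule odd_pos)
  assume "\<not> ?thesis"
  then have "card (f ` {..<n}) = 2"
    using card_image_ge_2_if_consecutive_neq[of n f, OF \<open>n > 0\<close> neq] by linarith
  then obtain x y where xy: "f ` {..<n} = {x, y}"
    unfolding card_2_iff by blast
  have two: "f i = x \<or> f i = y" if "i < n" for i
  proof -
    have "f i \<in> f ` {..<n}"
      using that by simp
    then show ?thesis
      unfolding xy by simp
  qed
  have alternate: "f i = f 0 \<longleftrightarrow> even i" if "i < n" for i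
    using that
  proof (induction i)
    case (Suc i)
    have "f i \<noteq> f (Suc i)"
      using neq[of i] Suc.prems by simp
    then have "f (Suc i) = f 0 \<longleftrightarrow> f i \<noteq> f 0"
      using two[of i] two[of "Suc i"] two[of 0] Suc.prems \<open>n > 0\<close> by (metis Suc_lessD)
    then show ?case
      using Suc by simp
  qed simp
  \<comment> \<open>For odd \<open>n\<close> the index \<open>n - 1\<close> is even, yet its cyclic
    successor is 0, so the alternation breaks at the wrap-around.\<close>
  have "f (n - 1) = f 0"
    using alternate[of "n - 1"] assms(1) \<open>n > 0\<close> by simp
  then show False
    using neq[of "n - 1"] \<open>n > 0\<close> by simp
qed

lemma cycle_sums_eq_image:
  "cycle_sums G g = (\<lambda>i. g ! i \<otimes>\<^bsub>G\<^esub> g ! (Suc i mod length g)) ` {..<length g}"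
  by (auto simp: cycle_sums_def)

text \<open>Commutativity lets the shared entry be cancelled from both sums, which leaves two
  entries that are two places apart and hence distinct.\<close>

lemma (in comm_group) consecutive_sums_neq:
  assumes g: "distinct g" "set g \<subseteq> carrier G" and len: "length g \<ge> 3" "i < length g"
  defines "s \<equiv> \<lambda>i. g ! i \<otimes> g ! (Suc i mod length g)"
  shows "s i \<noteq> s (Suc i mod length g)"
proof
  define j k where "j = Suc i mod length g" and "k = Suc j mod length g"
  have lt: "j < length g" "k < length g"
    unfolding j_def k_def using len by (auto intro!: mod_less_divisor)
  then have mem: "g ! i \<in> carrier G" "g ! j \<in> carrier G" "g ! k \<in> carrier G"
    using g(2) len(2) by auto
  assume "s i = s (Suc i mod length g)"
  then have "g ! j \<otimes> g ! i = g ! j \<otimes> g ! k"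
    using mem by (simp add: s_def j_def k_def m_comm)
  then have "g ! i = g ! k"
    using mem by simp
  then have "i = k"
    using nth_eq_iff_index_eq[OF g(1)] lt len(2) by blast
  then show False
    using Suc_mod_Suc_mod_neq[OF len] by (simp add: j_def k_def)
qed

text \<open>A generator has order \<open>order G\<close>, so its powers below that exponent are
  distinct, and by counting they exhaust the group.\<close>

lemma (in group) bij_betw_pow_generator:
  assumes "finite (carrier G)" "a \<in> carrier G" "carrier G = range (\<lambda>k::int. a [^] k)"
  shows "bij_betw (\<lambda>k::nat. a [^] k) {..<order G} (carrier G)"
proof -
  have "generate G {a} = carrier G"
    using generate_pow[OF assms(2)] assms(3) by auto
  then have ord: "ord a = order G"
    using generate_pow_card[OF assms(2)] by (simp add: order_def)
  have inj: "inj_on (\<lambda>k::nat. a [^] k) {..<order G}"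
  proof (rule inj_on_subset[OF ord_inj[OF assms(2)]])
    show "{..<order G} \<subseteq> {0..ord a - 1}"
      unfolding ord by auto
  qed
  moreover have "(\<lambda>k::nat. a [^] k) ` {..<order G} = carrier G"
    using assms(1,2) card_image[OF inj]
    by (intro card_subset_eq) (auto simp: order_def)
  ultimately show ?thesis
    by (simp add: bij_betw_def)
qed

text \<open>Reduces the construction of a cycle to an injective self-map of the exponents, and its
  sums to additions of natural numbers.\<close>

lemma (in group) ham_cycle_of_exponents:
  assumes a: "a \<in> carrier G" "bij_betw (\<lambda>k::nat. a [^] k) {..<order G} (carrier G)"
    and f: "inj_on f {..<order G}" "f ` {..<order G} \<subseteq> {..<order G}"
    and "order G \<ge> 2"
  obtains g where "g \<in> ham_cycles G"
    and "cycle_sums G g = (\<lambda>i. a [^] (f i + f (Suc i mod order G))) ` {..<order G}"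
proof
  let ?g = "map (\<lambda>i. a [^] f i) [0..<order G]"
  have "bij_betw f {..<order G} {..<order G}"
    using endo_inj_surj[OF _ f(2,1)] f(1) by (simp add: bij_betw_def)
  then have "bij_betw ((\<lambda>k. a [^] k) \<circ> f) {..<order G} (carrier G)"
    by (rule bij_betw_trans[OF _ a(2)])
  then have "distinct ?g" "set ?g = carrier G"
    by (simp_all add: bij_betw_def distinct_map o_def atLeast0LessThan)
  then show "?g \<in> ham_cycles G"
    using \<open>order G \<ge> 2\<close> by (simp add: ham_cycles_eq order_def)
  have "?g ! i \<otimes> ?g ! (Suc i mod order G) = a [^] (f i + f (Suc i mod order G))"
    if "i < order G" for i
  proof -
    have "Suc i mod order G < order G"
      using that by (intro mod_less_divisor) linarith
    then show ?thesis
      using that a(1) by (simp add: nat_pow_mult)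
  qed
  then show "cycle_sums G ?g = (\<lambda>i. a [^] (f i + f (Suc i mod order G))) ` {..<order G}"
    by (simp add: cycle_sums_eq_image)
qed

text \<open>The lower bound also applies to the witness \<open>g\<close>, so an upper estimate for
  its number of sums already gives equality.\<close>

lemma s_min_eqI:
  assumes "finite (carrier G)" "g \<in> ham_cycles G" "card (cycle_sums G g) \<le> m"
    and lower: "\<And>h. h \<in> ham_cycles G \<Longrightarrow> m \<le> card (cycle_sums G h)"
  shows "s_min G = m"
  unfolding s_min_def
proof (rule Min_eqI)
  have "ham_cycles G \<subseteq> {g. set g \<subseteq> carrier G \<and> distinct g}"
    by (auto simp: ham_cycles_def hamiltonian_cycle_iff complete_digraph_on_def)
  then show "finite ((\<lambda>g. card (cycle_sums G g)) ` ham_cycles G)"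
    using finite_subset_distinct[OF assms(1)] by (meson finite_imageI finite_subset)
  show "m \<in> (\<lambda>g. card (cycle_sums G g)) ` ham_cycles G"
    using assms(2,3) lower[OF assms(2)] by (intro image_eqI[of _ _ g]) auto
qed (use lower in auto)

theorem theorem5:
  fixes G :: "('a, 'b) monoid_scheme"
  assumes "group G" and "finite (carrier G)" and "cyclic_group G" and "order G \<ge> 3"
  shows "(even (order G) \<longrightarrow> s_min G = 2) \<and> (odd (order G) \<longrightarrow> s_min G = 3)"
proof -
  interpret comm_group G
    using \<open>group G\<close> \<open>cyclic_group G\<close> by (rule group.cyclic_imp_abelian_group)
  define n where "n = order G"
  have n: "n \<ge> 3" using assms(4) by (simp add: n_def)
  obtain a where a: "a \<in> carrier G" "carrier G = range (\<lambda>k::int. a [^]\<^bsub>G\<^esub> k)"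
    using \<open>cyclic_group G\<close> cyclic_group by blast
  have "n \<ge> 2" using n by simp
  note cycle_of = ham_cycle_of_exponents[OF a(1) bij_betw_pow_generator[OF assms(2) a],
      folded n_def, OF _ _ this]
  \<comment> \<open>Exponents are added without reduction modulo \<open>n\<close>, so the cycles
    below produce \<open>n\<close> and \<open>n + 1\<close>; these two facts bring them back to 0
    and 1.\<close>
  have pow_n: "a [^]\<^bsub>G\<^esub> n = \<one>\<^bsub>G\<^esub>"
    using a(1) pow_order_eq_1 by (simp add: n_def)
  then have pow_Suc_n: "a [^]\<^bsub>G\<^esub> (n + 1) = a [^]\<^bsub>G\<^esub> (1::nat)"
    using a(1) by simp

  have lower: "card (cycle_sums G h) \<ge> 2" "odd n \<Longrightarrow> card (cycle_sums G h) \<ge> 3"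
    if "h \<in> ham_cycles G" for h
  proof -
    have h: "distinct h" "set h = carrier G"
      using that assms(4) by (auto simp: ham_cycles_eq order_def)
    then have len: "length h = n"
      using distinct_card[of h] by (simp add: n_def order_def)
    have neq: "h ! i \<otimes>\<^bsub>G\<^esub> h ! (Suc i mod n) \<noteq>
        h ! (Suc i mod n) \<otimes>\<^bsub>G\<^esub> h ! (Suc (Suc i mod n) mod n)" if "i < n" for i
      using consecutive_sums_neq[of h i] h n len that by simp
    show "card (cycle_sums G h) \<ge> 2"
      unfolding cycle_sums_eq_image len
      using n by (intro card_image_ge_2_if_consecutive_neq neq) auto
    show "card (cycle_sums G h) \<ge> 3" if "odd n"
      unfolding cycle_sums_eq_image len
      using that by (intro card_image_ge_3_if_consecutive_neq neq)
  qed

  have "s_min G = 2" if "even n"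
  proof -
    \<comment> \<open>The exponents of 0, -1, 2, -3, ..., with \<open>n - i\<close> standing for
      \<open>-i\<close>.\<close>
    define f where "f i = (if even i then i else n - i)" for i
    have inj: "inj_on f {..<n}"
    proof (rule inj_onI)
      fix i j assume ij: "i \<in> {..<n}" "j \<in> {..<n}" "f i = f j"
      \<comment> \<open>As \<open>n\<close> is even, \<open>n - k\<close> has the parity of
        \<open>k\<close>, so the value reveals which branch of \<open>f\<close> was taken.\<close>
      have parity: "even k \<longleftrightarrow> even (f k)" if "k < n" for k
        using \<open>even n\<close> that by (cases "even k") (auto simp: f_def)
      have "even i \<longleftrightarrow> even j"
        using parity[of i] parity[of j] ij by simp
      then show "i = j"
        using ij by (cases "even i") (auto simp: f_def)
    qed
    have ran: "f ` {..<n} \<subseteq> {..<n}"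
      by (auto simp: f_def odd_pos)
    obtain g where g: "g \<in> ham_cycles G"
      "cycle_sums G g = (\<lambda>i. a [^]\<^bsub>G\<^esub> (f i + f (Suc i mod n))) ` {..<n}"
      by (rule cycle_of[OF inj ran])
    have "a [^]\<^bsub>G\<^esub> (f i + f (Suc i mod n)) \<in> {a [^]\<^bsub>G\<^esub> (n - 1), a [^]\<^bsub>G\<^esub> (1::nat)}"
      if "i < n" for i
    proof -
      \<comment> \<open>The three cases give \<open>n - 1\<close>, \<open>n + 1\<close> and 1 in
        turn; the closing sum 1 agrees with \<open>n + 1\<close> modulo \<open>n\<close>, so only
        two elements arise.\<close>
      consider "even i" "Suc i < n" | "odd i" "Suc i < n" | "odd i" "Suc i = n"
        using \<open>i < n\<close> \<open>even n\<close> by (metis Suc_lessI even_Suc)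
      then have "f i + f (Suc i mod n) \<in> {n - 1, n + 1, 1}"
        by cases (auto simp: f_def)
      then show ?thesis
        by (elim insertE emptyE) (simp_all only: pow_Suc_n insert_iff simp_thms)
    qed
    then have "cycle_sums G g \<subseteq> {a [^]\<^bsub>G\<^esub> (n - 1), a [^]\<^bsub>G\<^esub> (1::nat)}"
      unfolding g(2) by (intro image_subsetI) (simp only: lessThan_iff)
    then have "card (cycle_sums G g) \<le> card {a [^]\<^bsub>G\<^esub> (n - 1), a [^]\<^bsub>G\<^esub> (1::nat)}"
      by (intro card_mono) auto
    also have "\<dots> \<le> 2"
      by (simp add: card_insert_if)
    finally show ?thesis
      using s_min_eqI[OF assms(2) g(1)] lower(1) by blast
  qed
  moreover have "s_min G = 3" if "odd n"
  proof -
    \<comment> \<open>The exponents \<open>0, n - 1, 1, n - 2, 2, ...\<close>, which represent 0,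
      -1, 1, -2, 2, ...\<close>
    define f where "f i = (if even i then i div 2 else n - 1 - i div 2)" for i
    have inj: "inj_on f {..<n}"
    proof (rule inj_onI)
      fix i j assume ij: "i \<in> {..<n}" "j \<in> {..<n}" "f i = f j"
      \<comment> \<open>Even indices take the exponents up to \<open>(n - 1) div 2\<close> and odd
        indices those above, so the size of the value reveals the branch.\<close>
      have parity: "even k \<longleftrightarrow> 2 * f k < n" if "k < n" for k
        using \<open>odd n\<close> that by (cases "even k") (auto simp: f_def elim!: evenE oddE)
      have "even i \<longleftrightarrow> even j"
        using parity[of i] parity[of j] ij by simp
      then show "i = j"
        using ij by (cases "even i") (auto simp: f_def elim!: evenE oddE)
    qed
    have ran: "f ` {..<n} \<subseteq> {..<n}"
      by (auto simp: f_def)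
    obtain g where g: "g \<in> ham_cycles G"
      "cycle_sums G g = (\<lambda>i. a [^]\<^bsub>G\<^esub> (f i + f (Suc i mod n))) ` {..<n}"
      by (rule cycle_of[OF inj ran])
    let ?S = "{a [^]\<^bsub>G\<^esub> (n - 1), \<one>\<^bsub>G\<^esub>, a [^]\<^bsub>G\<^esub> ((n - 1) div 2)}"
    have "a [^]\<^bsub>G\<^esub> (f i + f (Suc i mod n)) \<in> ?S" if "i < n" for i
    proof -
      \<comment> \<open>The cases give \<open>n - 1\<close>, \<open>n\<close> and
        \<open>(n - 1) div 2\<close> in turn; the last is the closing sum, from the final exponent
        \<open>(n - 1) div 2\<close> back to 0.\<close>
      consider "even i" "Suc i < n" | "odd i" "Suc i < n" | "even i" "Suc i = n"
        using \<open>i < n\<close> \<open>odd n\<close> by (metis Suc_lessI even_Suc)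
      then have "f i + f (Suc i mod n) \<in> {n - 1, n, (n - 1) div 2}"
        by cases (auto simp: f_def elim!: oddE evenE)
      then show ?thesis
        by (elim insertE emptyE) (simp_all only: pow_n insert_iff simp_thms)
    qed
    then have "cycle_sums G g \<subseteq> ?S"
      unfolding g(2) by (intro image_subsetI) (simp only: lessThan_iff)
    then have "card (cycle_sums G g) \<le> card ?S"
      by (intro card_mono) auto
    also have "\<dots> \<le> 3"
      by (simp add: card_insert_if)
    finally show ?thesis
      using s_min_eqI[OF assms(2) g(1)] lower(2) \<open>odd n\<close> by blast
  qed
  ultimately show ?thesis
    by (simp add: n_def)
qed

end
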